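(* Let $(X,d)$ be a metric space and let $f_n:X\to X$, $n\ge 0$, be a sequence of maps, defining the non-autonomous discrete system $x_{n+1}=f_n(x_n)$, $n\ge0$. Let $N\ge 2$ and let $A=(a_{ij})_{N\times N}$ be an irreducible transition matrix with $\sum_{j=1}^{N}a_{i_0j}\ge 2$ for some $1\le i_0\le N$. Let $V_1,\dots,V_N$ be pairwise disjoint nonempty compact subsets of $X$, assume that $\{f_n\}_{n=0}^\infty$ is equi-continuous in $\bigcup_{i=1}^N V_i$, and for each $1\le i\le N$ let $\{V_{i,n}\}_{n=0}^\infty$ be a sequence of nonempty closed subsets of $V_i$. Suppose that (i) the system is weakly $A$-coupled-expanding in $\{V_{i,n}\}_{n=0}^\infty$, $1\le i\le N$; (ii) there exists a constant $\lambda>1$ such that $$d(f_n(x),f_n(y))\ge\lambda\, d(x,y)\quad\text{for all } x,y\in V_{j,n},\ 1\le j\le N,\ n\ge0.$$ Then the system $x_{n+1}=f_n(x_n)$, $n\ge0$, is distributionally $\delta$-chaotic for some $\delta>0$.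
   Context: Notation: for $n\ge1$, $f_0^n:=f_{n-1}\circ\cdots\circ f_0$, and $f_0^0$ is the identity. $\{f_n\}$ is equi-continuous in a set $V$ if for every $\epsilon>0$ there is $\eta>0$ such that $d(f_n(x),f_n(y))<\epsilon$ for all $n\ge0$ and all $x,y\in V$ with $d(x,y)<\eta$. A matrix $A=(a_{ij})_{N\times N}$ ($N\ge2$) is a transition matrix if $a_{ij}\in\{0,1\}$ for all $i,j$, $\sum_{j}a_{ij}\ge1$ for all $i$, and $\sum_i a_{ij}\ge1$ for all $j$. It is irreducible if for each pair $1\le i,j\le N$ there is a positive integer $k$ such that the $(i,j)$ entry of $A^k$ is positive. Given sequences $\{V_{i,n}\}_{n\ge0}$, $1\le i\le N$, of nonempty subsets of $X$ with $V_{i,n}\cap V_{j,n}=\partial V_{i,n}\cap\partial V_{j,n}$ for all $i\ne j$ and $n\ge0$ ($\partial$ denotes boundary), the system is weakly $A$-coupled-expanding in $\{V_{i,n}\}_{n=0}^\infty$, $1\le i\le N$, if $f_n(V_{i,n})\supset\bigcup_{j:\,a_{ij}=1}V_{j,n+1}$ for all $1\le i\le N$, $n\ge0$. The system $x_{n+1}=f_n(x_n)$ is distributionally $\delta$-chaotic ($\delta>0$) if there is an uncountable set $D\subset X$ such that for all distinct $x,y\in D$ and every $\epsilon>0$, $$\limsup_{n\to\infty}\frac1n\sum_{j=0}^{n-1}\chi_{[0,\epsilon)}\big(d(f_0^{j}(x),f_0^{j}(y))\big)=1,\qquad \liminf_{n\to\infty}\frac1n\sum_{j=0}^{n-1}\chi_{[0,\delta)}\big(d(f_0^{j}(x),f_0^{j}(y))\big)=0,$$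 where $\chi_{[0,\epsilon)}$ is the characteristic function of $[0,\epsilon)$. *)

theory Defs
  imports "HOL-Analysis.Analysis" "Jordan_Normal_Form.Matrix"
begin

text \<open>
  Indices \<open>1, \<dots>, N\<close> of the mathematical text are shifted to \<open>0, \<dots>, N - 1\<close>,
  in accordance with the indexing of \<^typ>\<open>'a mat\<close>.
\<close>

definition transition_mat :: "nat \<Rightarrow> nat mat \<Rightarrow> bool" where
  "transition_mat N A \<longleftrightarrow>
     2 \<le> N \<and> A \<in> carrier_mat N N \<and>
     (\<forall>i<N. \<forall>j<N. A $$ (i, j) \<in> {0, 1}) \<and>
     (\<forall>i<N. 1 \<le> (\<Sum>j<N. A $$ (i, j))) \<and>
     (\<forall>j<N. 1 \<le> (\<Sum>i<N. A $$ (i, j)))"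

definition irreducible_mat :: "nat \<Rightarrow> nat mat \<Rightarrow> bool" where
  "irreducible_mat N A \<longleftrightarrow>
     (\<forall>i<N. \<forall>j<N. \<exists>k>0. (A ^\<^sub>m k) $$ (i, j) > 0)"

primrec iter_seq :: "(nat \<Rightarrow> 'a \<Rightarrow> 'a) \<Rightarrow> nat \<Rightarrow> 'a \<Rightarrow> 'a" where
  "iter_seq f 0 = id"
| "iter_seq f (Suc n) = f n \<circ> iter_seq f n"

definition equi_continuous_in ::
    "(nat \<Rightarrow> 'a::metric_space \<Rightarrow> 'a) \<Rightarrow> 'a set \<Rightarrow> bool" where
  "equi_continuous_in f V \<longleftrightarrow>
     (\<forall>\<epsilon>>0. \<exists>\<eta>>0. \<forall>n. \<forall>x\<in>V. \<forall>y\<in>V. dist x y < \<eta> \<longrightarrow> dist (f n x) (f n y) < \<epsilon>)"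

definition weakly_coupled_expanding ::
    "nat \<Rightarrow> nat mat \<Rightarrow> (nat \<Rightarrow> 'a::metric_space \<Rightarrow> 'a) \<Rightarrow> (nat \<Rightarrow> nat \<Rightarrow> 'a set) \<Rightarrow> bool" where
  "weakly_coupled_expanding N A f V \<longleftrightarrow>
     (\<forall>i<N. \<forall>n. V i n \<noteq> {}) \<and>
     (\<forall>i<N. \<forall>j<N. \<forall>n. i \<noteq> j \<longrightarrow>
        V i n \<inter> V j n = frontier (V i n) \<inter> frontier (V j n)) \<and>
     (\<forall>i<N. \<forall>n. (\<Union>j\<in>{j. j < N \<and> A $$ (i, j) = 1}. V j (Suc n)) \<subseteq> f n ` V i n)"

definition close_freq ::
    "(nat \<Rightarrow> 'a::metric_space \<Rightarrow> 'a) \<Rightarrow> 'a \<Rightarrow> 'a \<Rightarrow> real \<Rightarrow> nat \<Rightarrow> real" where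
  "close_freq f x y \<epsilon> n =
     1 / real n * (\<Sum>j<n. indicator {0..<\<epsilon>} (dist (iter_seq f j x) (iter_seq f j y)))"

text \<open>
  Upper and lower limits are taken in \<^typ>\<open>ereal\<close>, since \<^const>\<open>limsup\<close> and
  \<^const>\<open>liminf\<close> require a complete lattice.
\<close>

definition distributionally_chaotic ::
    "(nat \<Rightarrow> 'a::metric_space \<Rightarrow> 'a) \<Rightarrow> real \<Rightarrow> bool" where
  "distributionally_chaotic f \<delta> \<longleftrightarrow>
     (\<exists>D. uncountable D \<and>
        (\<forall>x\<in>D. \<forall>y\<in>D. x \<noteq> y \<longrightarrow>
           (\<forall>\<epsilon>>0. limsup (\<lambda>n. ereal (close_freq f x y \<epsilon> n)) = 1 \<and>
                   liminf (\<lambda>n. ereal (close_freq f x y \<delta> n)) = 0)))"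

end

theory Submission
  imports Defs
begin

text \<open>
  The branching row and irreducibility give two loops at one index that differ in their second
  symbol and that share the product \<open>p\<close> of their lengths as a common period.  A Boolean sequence
  \<open>t\<close> thus yields an admissible itinerary: on the \<open>m\<close>-th block of \<open>p\<close> times run through the
  first or the second loop, according to \<open>t m\<close>.  By compactness every itinerary is followed by
  some point.

  If two itineraries agree during \<open>L\<close> steps, expansion makes the two orbits \<open>M / \<lambda>\<^sup>L\<close>-close,
  with \<open>M\<close> the diameter of \<open>\<Union>i. V i\<close>;
  if they differ at some time within the next \<open>p + 1\<close> steps, equi-continuity, applied backwards
  from that time, keeps the two orbits apart by a fixed \<open>\<delta>\<close>.  It remains to choose uncountably
  many \<open>t\<close> any two of which agree on infinitely many of the windows \<open>[k!, (k + 1)!)\<close> and are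
  opposite on infinitely many others; each such window outweighs all preceding time.
\<close>

section \<open>Walks and loops\<close>

text \<open>A positive entry of \<open>A ^\<^sub>m Suc k\<close> is a sum of products of natural
  numbers, so some product is positive: a walk of length \<open>k\<close> to some \<open>l\<close>,
  followed by an edge from \<open>l\<close> to \<open>j\<close>.\<close>

lemma walk_of_pow_mat_pos:
  fixes A :: "nat mat"
  assumes A: "A \<in> carrier_mat N N" and A01: "\<And>i j. i < N \<Longrightarrow> j < N \<Longrightarrow> A $$ (i, j) \<in> {0, 1}"
    and "i < N" "j < N" "(A ^\<^sub>m k) $$ (i, j) > 0"
  obtains w where "w 0 = i" "w k = j" "\<And>m. m \<le> k \<Longrightarrow> w m < N"
    "\<And>m. m < k \<Longrightarrow> A $$ (w m, w (Suc m)) = 1"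
proof -
  have "\<exists>w. w 0 = i \<and> w k = j \<and> (\<forall>m\<le>k. w m < N) \<and> (\<forall>m<k. A $$ (w m, w (Suc m)) = 1)"
    using assms(4,5)
  proof (induction k arbitrary: j)
    case 0
    then have "i = j"
      using A \<open>i < N\<close> by (auto split: if_splits)
    then show ?case
      using \<open>i < N\<close> by auto
  next
    case (Suc k)
    have P: "A ^\<^sub>m k \<in> carrier_mat N N"
      using A by simp
    have "(A ^\<^sub>m Suc k) $$ (i, j) = (\<Sum>l = 0..<N. (A ^\<^sub>m k) $$ (i, l) * A $$ (l, j))"
      using A P \<open>i < N\<close> \<open>j < N\<close> by (simp add: scalar_prod_def)
    with Suc.prems obtain l where l: "l < N" "(A ^\<^sub>m k) $$ (i, l) > 0" "A $$ (l, j) > 0"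
      by (metis (no_types, lifting) atLeastLessThan_iff gr0I mult_is_0 not_less_zero sum.neutral)
    from Suc.IH[OF l(1,2)] obtain w where w: "w 0 = i" "w k = l" "\<forall>m\<le>k. w m < N"
      "\<forall>m<k. A $$ (w m, w (Suc m)) = 1" by blast
    have "A $$ (l, j) = 1"
      using A01[OF l(1) Suc.prems(1)] l(3) by auto
    then show ?case
      using w Suc.prems(1)
      by (intro exI[of _ "w(Suc k := j)"]) (auto simp: less_Suc_eq le_Suc_eq)
  qed
  then show ?thesis
    using that by blast
qed

text \<open>Irreducibility supplies a walk of length \<open>k > 0\<close> back from \<open>j\<close>
  to \<open>i\<close>. Prefixing the edge from \<open>i\<close> to \<open>j\<close> closes it into a
  loop of length \<open>k + 1 > 1\<close>, which is then repeated periodically.\<close>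

lemma loop_through:
  fixes A :: "nat mat"
  assumes A: "A \<in> carrier_mat N N" and A01: "\<And>i j. i < N \<Longrightarrow> j < N \<Longrightarrow> A $$ (i, j) \<in> {0, 1}"
    and irr: "irreducible_mat N A" and "i < N" "j < N" "A $$ (i, j) = 1"
  obtains q u where "1 < q" "u 0 = i" "u 1 = j" "\<And>m. u m < N"
    "\<And>m. A $$ (u m, u (Suc m)) = 1" "\<And>m. u (m mod q) = u m"
proof -
  obtain k where k: "k > 0" "(A ^\<^sub>m k) $$ (j, i) > 0"
    using irr \<open>i < N\<close> \<open>j < N\<close> unfolding irreducible_mat_def by blast
  obtain w where w: "w 0 = j" "w k = i" "\<And>m. m \<le> k \<Longrightarrow> w m < N"
    "\<And>m. m < k \<Longrightarrow> A $$ (w m, w (Suc m)) = 1"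
    using walk_of_pow_mat_pos[OF A A01 \<open>j < N\<close> \<open>i < N\<close> k(2)] by blast
  define c where "c m = (case m of 0 \<Rightarrow> i | Suc m' \<Rightarrow> w m')" for m
  have c: "c 0 = i" "c 1 = j" "c (Suc k) = i" "\<And>m. m \<le> Suc k \<Longrightarrow> c m < N"
    "\<And>m. m < Suc k \<Longrightarrow> A $$ (c m, c (Suc m)) = 1"
    using w \<open>i < N\<close> \<open>A $$ (i, j) = 1\<close> by (auto simp: c_def split: nat.splits)
  define u where "u m = c (m mod Suc k)" for m
  have "A $$ (u m, u (Suc m)) = 1" for m
    \<comment> \<open>At the wrap-around \<open>m mod Suc k = k\<close> the next symbol is
      \<open>c 0\<close>, which equals \<open>c (Suc k)\<close>.\<close>
    using c(5)[of "m mod Suc k"] c(1,3) by (cases "m mod Suc k = k") (auto simp: u_def mod_Suc)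
  moreover have "u m < N" for m
    using c(4)[of "m mod Suc k"] by (simp add: u_def less_imp_le)
  moreover have "u 1 = j"
    using k(1) c(2) by (simp add: u_def)
  ultimately show ?thesis
    using that[of "Suc k" u] k(1) c(1) by (simp add: u_def)
qed

text \<open>A sum of entries 0 and 1 counts the entries equal to 1.\<close>

lemma sum_ge_2_two_entries:
  fixes a :: "nat \<Rightarrow> nat"
  assumes "(\<Sum>j<N. a j) \<ge> 2" and "\<And>j. j < N \<Longrightarrow> a j \<in> {0, 1}"
  obtains j1 j2 where "j1 < N" "j2 < N" "j1 \<noteq> j2" "a j1 = 1" "a j2 = 1"
proof -
  have "(\<Sum>j<N. a j) = card {j. j < N \<and> a j = 1}"
  proof -
    have "(\<Sum>j<N. a j) = (\<Sum>j\<in>{j. j < N \<and> a j = 1}. a j)"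
      using assms(2) by (intro sum.mono_neutral_right) force+
    then show ?thesis by simp
  qed
  with assms(1) have "card {j. j < N \<and> a j = 1} \<ge> 2"
    by simp
  then obtain x y where "x \<noteq> y" "x \<in> {j. j < N \<and> a j = 1}" "y \<in> {j. j < N \<and> a j = 1}"
    by (metis (no_types, lifting) card_le_Suc_iff numeral_2_eq_2 insertCI)
  then show ?thesis
    using that by blast
qed

text \<open>The itinerary can change loops only at multiples of \<open>p\<close>, where both loops
  are at their common base symbol.\<close>

lemma itinerary_from_loops:
  fixes A :: "nat mat" and t :: "nat \<Rightarrow> bool"
  assumes u: "\<And>m. A $$ (u m, u (Suc m)) = 1" "\<And>m. u (m mod p) = u m"
    and v: "\<And>m. A $$ (v m, v (Suc m)) = 1" "\<And>m. v (m mod p) = v m"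
    and "u 0 = v 0" and s: "\<And>n. s n = (if t (n div p) then u n else v n)"
  shows "A $$ (s n, s (Suc n)) = 1"
proof (cases "Suc n mod p = 0")
  case True
  then have "u (Suc n) = v (Suc n)"
    using u(2)[of "Suc n"] v(2)[of "Suc n"] \<open>u 0 = v 0\<close> by simp
  \<comment> \<open>Whichever loop governs the new block, its first symbol continues the loop being
    left.\<close>
  then have "s (Suc n) = u (Suc n)" "s (Suc n) = v (Suc n)"
    by (simp_all add: s)
  then show ?thesis
    using u(1)[of n] v(1)[of n] by (cases "t (n div p)") (simp_all add: s[of n])
next
  case False
  then have "Suc n div p = n div p"
    by (simp add: div_Suc)
  then show ?thesis
    using u(1)[of n] v(1)[of n] by (simp add: s)
qed

section \<open>Orbits following an itinerary\<close>

definition follows ::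
    "(nat \<Rightarrow> 'a::metric_space \<Rightarrow> 'a) \<Rightarrow> (nat \<Rightarrow> nat \<Rightarrow> 'a set) \<Rightarrow> (nat \<Rightarrow> nat) \<Rightarrow> 'a \<Rightarrow> bool" where
  "follows f W s x \<longleftrightarrow> (\<forall>n. iter_seq f n x \<in> W (s n) n)"

lemma equi_continuous_in_continuous_on:
  assumes "equi_continuous_in f V"
  shows "continuous_on V (f n)"
  unfolding continuous_on_iff
proof (intro ballI allI impI)
  fix x and e :: real
  assume "x \<in> V" "e > 0"
  obtain \<eta> where "\<eta> > 0" "\<forall>n. \<forall>x\<in>V. \<forall>y\<in>V. dist x y < \<eta> \<longrightarrow> dist (f n x) (f n y) < e"
    using assms \<open>e > 0\<close> unfolding equi_continuous_in_def by blast
  then show "\<exists>d>0. \<forall>x'\<in>V. dist x' x < d \<longrightarrow> dist (f n x') (f n x) < e"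
    using \<open>x \<in> V\<close> by blast
qed

lemma disjoint_compacts_apart:
  fixes S T :: "'a::metric_space set"
  assumes "compact S" "compact T" "S \<inter> T = {}"
  shows "\<exists>d>0. \<forall>x\<in>S. \<forall>y\<in>T. d \<le> dist x y"
proof (cases "S \<times> T = {}")
  case True
  then show ?thesis
    by (intro exI[of _ 1]) auto
next
  case False
  have "continuous_on (S \<times> T) (\<lambda>z. dist (fst z) (snd z))"
    by (intro continuous_intros)
  then obtain z where z: "z \<in> S \<times> T" "\<forall>w\<in>S \<times> T. dist (fst z) (snd z) \<le> dist (fst w) (snd w)"
    using continuous_attains_inf[OF compact_Times[OF assms(1,2)] False] by blast
  then have "dist (fst z) (snd z) > 0"
    using assms(3) by (auto simp: mem_Times_iff)
  then show ?thesis
    using z(2) by (intro exI[of _ "dist (fst z) (snd z)"]) auto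
qed

text \<open>The points that follow \<open>s\<close> up to time \<open>n\<close> form decreasing
  closed sets. The covering condition makes the \<open>n\<close>-th iterate map the
  \<open>n\<close>-th of them onto \<open>W (s n) n\<close>, so none is empty, and compactness of
  \<open>K\<close> yields a common point.\<close>

lemma follows_exists:
  fixes f :: "nat \<Rightarrow> 'a::metric_space \<Rightarrow> 'a"
  assumes "compact K" and K: "\<And>n. W (s n) n \<subseteq> K" and cl: "\<And>n. closed (W (s n) n)"
    and ne: "\<And>n. W (s n) n \<noteq> {}" and cont: "\<And>n. continuous_on K (f n)"
    and cover: "\<And>n. W (s (Suc n)) (Suc n) \<subseteq> f n ` W (s n) n"
  shows "\<exists>x. follows f W s x"
proof -
  define S where "S n = {x. \<forall>k\<le>n. iter_seq f k x \<in> W (s k) k}" for n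
  have S_Suc: "S (Suc n) = S n \<inter> iter_seq f (Suc n) -` W (s (Suc n)) (Suc n)" for n
    by (auto simp: S_def le_Suc_eq)
  \<comment> \<open>Both claims need a joint induction: \<open>f n\<close> is continuous only on
    \<open>K\<close>, so the iterates are controlled only on \<open>S n\<close>, and
    \<open>S (Suc n)\<close> is a preimage relative to the closed set \<open>S n\<close>.\<close>
  have "closed (S n) \<and> continuous_on (S n) (iter_seq f n)" for n
  proof (induction n)
    case 0
    have "S 0 = W (s 0) 0"
      by (auto simp: S_def)
    then show ?case
      using cl[of 0] by (simp add: continuous_on_id id_def)
  next
    case (Suc n)
    have "iter_seq f n ` S n \<subseteq> K"
      using K[of n] by (auto simp: S_def)
    then have c: "continuous_on (S n) (iter_seq f (Suc n))"
      using Suc cont[of n] by (metis continuous_on_compose continuous_on_subset iter_seq.simps(2))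
    then have "closed (S (Suc n))"
      unfolding S_Suc using Suc cl by (blast intro: continuous_closed_preimage)
    moreover have "continuous_on (S (Suc n)) (iter_seq f (Suc n))"
      using c S_Suc by (metis continuous_on_subset inf_le1)
    ultimately show ?case by blast
  qed
  then have closed: "closed (S n)" for n
    by blast
  have onto: "W (s n) n \<subseteq> iter_seq f n ` S n" for n
  proof (induction n)
    case 0
    then show ?case by (auto simp: S_def)
  next
    case (Suc n)
    show ?case
    proof
      fix y assume y: "y \<in> W (s (Suc n)) (Suc n)"
      then obtain x where x: "x \<in> S n" "y = f n (iter_seq f n x)"
        using cover[of n] Suc by blast
      then have "x \<in> S (Suc n)"
        using y by (simp add: S_Suc)
      then show "y \<in> iter_seq f (Suc n) ` S (Suc n)"
        using x by auto
    qed
  qed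
  have "K \<inter> (\<Inter>n\<in>UNIV. S n) \<noteq> {}"
  proof (rule compact_imp_fip_image[OF \<open>compact K\<close>])
    fix I :: "nat set" assume "finite I"
    then obtain b where "\<forall>n\<in>I. n \<le> b"
      using finite_nat_set_iff_bounded_le by blast
    then have "S b \<subseteq> \<Inter>(S ` I)"
      by (auto simp: S_def)
    moreover have "S b \<subseteq> K"
      using K[of 0] by (force simp: S_def)
    moreover have "S b \<noteq> {}"
      using onto[of b] ne[of b] by auto
    ultimately show "K \<inter> \<Inter>(S ` I) \<noteq> {}"
      by blast
  qed (rule closed)
  then obtain x where "\<And>n. x \<in> S n"
    by blast
  then have "follows f W s x"
    by (auto simp: follows_def S_def)
  then show ?thesis ..
qed

text \<open>While the symbols agree, both orbits lie in one set of the family, where each step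
  expands distances by \<open>lam\<close>. Since later distances will be bounded, a long agreement
  forces closeness at its start.\<close>

lemma expansion_along_itinerary:
  fixes lam :: real
  assumes "lam \<ge> 0"
    and exp: "\<And>n x y. x \<in> W (s n) n \<Longrightarrow> y \<in> W (s n) n \<Longrightarrow> dist (f n x) (f n y) \<ge> lam * dist x y"
    and "follows f W s x" "follows f W s' y" and "\<And>i. i < L \<Longrightarrow> s (n + i) = s' (n + i)"
  shows "lam ^ L * dist (iter_seq f n x) (iter_seq f n y)
    \<le> dist (iter_seq f (n + L) x) (iter_seq f (n + L) y)"
  using assms(5)
proof (induction L)
  case (Suc L)
  let ?x = "iter_seq f (n + L) x" and ?y = "iter_seq f (n + L) y"
  have "?x \<in> W (s (n + L)) (n + L)" "?y \<in> W (s (n + L)) (n + L)"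
    using assms(3,4) Suc.prems[of L] unfolding follows_def by (metis lessI)+
  from exp[OF this] have "lam * dist ?x ?y \<le> dist (f (n + L) ?x) (f (n + L) ?y)" .
  moreover have "lam * (lam ^ L * dist (iter_seq f n x) (iter_seq f n y)) \<le> lam * dist ?x ?y"
    using Suc \<open>lam \<ge> 0\<close> by (intro mult_left_mono) auto
  ultimately show ?case
    by (simp add: mult.assoc)
qed simp

text \<open>The modulus does not depend on \<open>n\<close>. Read contrapositively, a separation by
  \<epsilon> at some time gives a uniform separation at each of the \<open>m\<close> preceding
  times.\<close>

lemma equi_continuous_in_iterates:
  fixes f :: "nat \<Rightarrow> 'a::metric_space \<Rightarrow> 'a" and \<epsilon> :: real
  assumes eq: "equi_continuous_in f K" and "\<epsilon> > 0"
  shows "\<exists>\<eta>>0. \<forall>n x y. (\<forall>i. iter_seq f i x \<in> K \<and> iter_seq f i y \<in> K) \<longrightarrow>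
    dist (iter_seq f n x) (iter_seq f n y) < \<eta> \<longrightarrow>
    (\<forall>i\<le>m. dist (iter_seq f (n + i) x) (iter_seq f (n + i) y) < \<epsilon>)"
proof (induction m)
  case 0
  then show ?case
    using \<open>\<epsilon> > 0\<close> by auto
next
  case (Suc m)
  then obtain \<eta> where \<eta>: "\<eta> > 0" and close: "\<And>n x y i. \<lbrakk>\<And>i. iter_seq f i x \<in> K \<and> iter_seq f i y \<in> K;
      dist (iter_seq f n x) (iter_seq f n y) < \<eta>; i \<le> m\<rbrakk> \<Longrightarrow>
      dist (iter_seq f (n + i) x) (iter_seq f (n + i) y) < \<epsilon>"
    by blast
  obtain \<theta> where \<theta>: "\<theta> > 0" and
    step: "\<And>n x y. x \<in> K \<Longrightarrow> y \<in> K \<Longrightarrow> dist x y < \<theta> \<Longrightarrow> dist (f n x) (f n y) < \<eta>"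
    using eq \<eta> unfolding equi_continuous_in_def by metis
  show ?case
  \<comment> \<open>The bound \<epsilon> settles \<open>i = 0\<close>; \<theta> brings the points
    within \<eta> after one step, from where the induction hypothesis covers the remaining
    \<open>m\<close> steps.\<close>
  proof (intro exI[of _ "min \<epsilon> \<theta>"] conjI allI impI)
    show "min \<epsilon> \<theta> > 0"
      using \<theta> \<open>\<epsilon> > 0\<close> by simp
    fix n x y i
    assume K: "\<forall>i. iter_seq f i x \<in> K \<and> iter_seq f i y \<in> K"
      and d: "dist (iter_seq f n x) (iter_seq f n y) < min \<epsilon> \<theta>" and "i \<le> Suc m"
    have d': "dist (iter_seq f (Suc n) x) (iter_seq f (Suc n) y) < \<eta>"
      using step[of "iter_seq f n x" "iter_seq f n y" n] K d by simp
    show "dist (iter_seq f (n + i) x) (iter_seq f (n + i) y) < \<epsilon>"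
    proof (cases i)
      case 0
      then show ?thesis using d by simp
    next
      case (Suc i')
      then show ?thesis
        using close[OF K[rule_format] d', of i'] \<open>i \<le> Suc m\<close> by simp
    qed
  qed
qed

section \<open>Coding Boolean sequences on factorial windows\<close>

text \<open>The least factorial exceeding \<open>m\<close> is the right end of the window containing
  \<open>m\<close>. As 0! = 1!, the window for \<open>k = 0\<close> is empty and the value 1 is
  never taken.\<close>

definition window_index :: "nat \<Rightarrow> nat" where
  "window_index m = (LEAST k. m < fact k)"

lemma window_index_eq:
  assumes "fact k \<le> m" "m < fact (Suc k)"
  shows "window_index m = Suc k"
  unfolding window_index_def
proof (rule Least_equality)
  show "m < fact (Suc k)"
    by (rule assms(2))
  fix l assume "m < fact l"
  with assms(1) have "fact k < (fact l :: nat)"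
    by simp
  then show "Suc k \<le> l"
    by (metis fact_mono_nat not_less not_less_eq_eq)
qed

text \<open>
  Each index of \<open>\<alpha>\<close>, shifted by one, governs infinitely many windows; index \<open>0\<close> stands for the
  windows on which all coded sequences agree.
\<close>
definition window_code :: "(nat \<Rightarrow> bool) \<Rightarrow> nat \<Rightarrow> bool" where
  "window_code \<alpha> m =
    (case fst (prod_decode (window_index m)) of 0 \<Rightarrow> True | Suc i \<Rightarrow> \<alpha> i)"

text \<open>The pairing function splits the window numbers into infinitely many infinite classes,
  one for each first component.\<close>

lemma windows_of_index:
  "\<exists>\<^sub>\<infinity>k. \<forall>m\<in>{fact k..<fact (Suc k)}. fst (prod_decode (window_index m)) = i"
  unfolding INFM_nat_le
proof
  fix b :: nat
  \<comment> \<open>The second component \<open>Suc b\<close> makes the code at least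
    \<open>Suc b\<close>; hence it is a successor \<open>Suc k\<close> with
    \<open>b \<le> k\<close>.\<close>
  obtain k where k: "prod_encode (i, Suc b) = Suc k"
    using le_prod_encode_2[of "Suc b" i] by (metis Suc_le_D)
  have "b \<le> k"
    using le_prod_encode_2[of "Suc b" i] k by simp
  moreover have "fst (prod_decode (Suc k)) = i"
    using k by (metis fst_conv prod_encode_inverse)
  ultimately show "\<exists>k\<ge>b. \<forall>m\<in>{fact k..<fact (Suc k)}. fst (prod_decode (window_index m)) = i"
    using window_index_eq by (intro exI[of _ k]) (metis atLeastLessThan_iff)
qed

lemma window_code_agree:
  "\<exists>\<^sub>\<infinity>k. \<forall>m\<in>{fact k..<fact (Suc k)}. window_code \<alpha> m = window_code \<beta> m"
  using windows_of_index[of 0] by (rule INFM_mono) (auto simp: window_code_def)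

text \<open>One coordinate at which \<alpha> and \<beta> differ suffices, since it governs
  infinitely many whole windows.\<close>

lemma window_code_opposite:
  assumes "\<alpha> \<noteq> \<beta>"
  shows "\<exists>\<^sub>\<infinity>k. \<forall>m\<in>{fact k..<fact (Suc k)}. window_code \<alpha> m \<noteq> window_code \<beta> m"
proof -
  obtain i where "\<alpha> i \<noteq> \<beta> i"
    using assms by blast
  then show ?thesis
    by (intro INFM_mono[OF windows_of_index[of "Suc i"]]) (auto simp: window_code_def)
qed

lemma uncountable_bool_sequences: "uncountable (UNIV :: (nat \<Rightarrow> bool) set)"
proof
  assume "countable (UNIV :: (nat \<Rightarrow> bool) set)"
  then obtain g :: "nat \<Rightarrow> nat \<Rightarrow> bool" where "range g = UNIV"
    by (metis UNIV_not_empty uncountable_def)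
  then obtain n where "g n = (\<lambda>i. \<not> g i i)"
    by (metis UNIV_I imageE)
  then show False
    by meson
qed

section \<open>Averages dominated by long windows\<close>

text \<open>At time \<open>n = p * fact (Suc k)\<close> all but \<open>p * fact k + C\<close> of the
  earlier times lie in the useful part of the window, and the exceptions have proportion at most
  \<open>(1 + C) / (k + 1)\<close>.\<close>

lemma average_near_window_value:
  fixes b :: "nat \<Rightarrow> real" and c e :: real
  assumes "p > 0" and b: "\<And>j. b j \<in> {0..1}" and c: "c \<in> {0..1}" and "e > 0"
    and win: "\<exists>\<^sub>\<infinity>k. \<forall>j. p * fact k \<le> j \<longrightarrow> j + C < p * fact (Suc k) \<longrightarrow> b j = c"
  shows "\<exists>\<^sub>F n in sequentially. \<bar>1 / real n * (\<Sum>j<n. b j) - c\<bar> < e"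
  unfolding frequently_sequentially
proof
  fix n0 :: nat
  obtain k0 :: nat where k0: "real (1 + C) / e < real k0"
    using reals_Archimedean2 by blast
  obtain k where k: "k \<ge> max n0 k0"
    and wk: "\<And>j. p * fact k \<le> j \<Longrightarrow> j + C < p * fact (Suc k) \<Longrightarrow> b j = c"
    using win unfolding INFM_nat_le by blast
  define n where "n = p * fact (Suc k)"
  have "Suc k \<le> fact (Suc k)"
    by (rule fact_ge_self)
  then have "Suc k \<le> n"
    using \<open>p > 0\<close> unfolding n_def by (metis One_nat_def Suc_leI mult.left_neutral mult_le_mono)
  have "\<bar>(\<Sum>j<n. b j) - real n * c\<bar> = \<bar>\<Sum>j<n. b j - c\<bar>"
    by (simp add: sum_subtractf)
  also have "\<dots> \<le> (\<Sum>j<n. \<bar>b j - c\<bar>)"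
    by (rule sum_abs)
  \<comment> \<open>Terms vanish except before the window and in its last \<open>C\<close> times,
    where they are at most 1.\<close>
  also have "\<dots> \<le> (\<Sum>j<n. indicator ({..<p * fact k} \<union> {n - C..<n}) j)"
  proof (rule sum_mono)
    fix j assume "j \<in> {..<n}"
    moreover have "\<bar>b j - c\<bar> \<le> 1"
      using b[of j] c by auto
    moreover have "b j = c" if "p * fact k \<le> j" "j + C < n"
      using wk that unfolding n_def by blast
    ultimately show "\<bar>b j - c\<bar> \<le> indicator ({..<p * fact k} \<union> {n - C..<n}) j"
      by (force simp: indicator_def)
  qed
  also have "\<dots> = real (card ({..<n} \<inter> ({..<p * fact k} \<union> {n - C..<n})))"
    by (simp only: indicator_def sum_of_bool_eq finite_lessThan Collect_mem_eq)
  also have "\<dots> \<le> real (card ({..<p * fact k} \<union> {n - C..<n}))"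
    by (intro of_nat_mono card_mono) auto
  also have "\<dots> \<le> real (p * fact k + C)"
    by (intro of_nat_mono order.trans[OF card_Un_le]) simp
  finally have sum: "\<bar>(\<Sum>j<n. b j) - real n * c\<bar> \<le> real (p * fact k + C)" .
  \<comment> \<open>The factor \<open>Suc k\<close> turns \<open>p * fact k\<close> into exactly
    \<open>n\<close>, and \<open>Suc k \<le> n\<close> handles \<open>C\<close>.\<close>
  have "Suc k * (p * fact k + C) \<le> n * (1 + C)"
  proof -
    have "Suc k * (p * fact k) = n"
      by (simp add: n_def algebra_simps)
    then show ?thesis
      using mult_right_mono[OF \<open>Suc k \<le> n\<close>, of C] by (simp add: distrib_left)
  qed
  then have "real (Suc k) * real (p * fact k + C) \<le> real n * real (1 + C)"
    by (metis of_nat_le_iff of_nat_mult)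
  moreover have "real (1 + C) < e * real (Suc k)"
  proof -
    have "real (1 + C) < e * real k0"
      using k0 \<open>e > 0\<close> by (simp add: divide_less_eq mult.commute)
    also have "\<dots> \<le> e * real (Suc k)"
      using k \<open>e > 0\<close> by (intro mult_left_mono) auto
    finally show ?thesis .
  qed
  moreover have n: "real n > 0"
    using \<open>Suc k \<le> n\<close> by simp
  ultimately have "real (Suc k) * real (p * fact k + C) < real n * (e * real (Suc k))"
    by (meson mult_strict_left_mono order.strict_trans1)
  then have "real (p * fact k + C) < e * real n"
    by (simp add: mult.commute mult.left_commute)
  with sum have "\<bar>(\<Sum>j<n. b j) - real n * c\<bar> < e * real n"
    by simp
  moreover have "1 / real n * (\<Sum>j<n. b j) - c = ((\<Sum>j<n. b j) - real n * c) / real n"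
    using n by (simp add: diff_divide_distrib)
  ultimately have "\<bar>1 / real n * (\<Sum>j<n. b j) - c\<bar> < e"
    using n by (simp add: abs_divide divide_less_eq)
  then show "\<exists>n\<ge>n0. \<bar>1 / real n * (\<Sum>j<n. b j) - c\<bar> < e"
    using k \<open>Suc k \<le> n\<close> by (intro exI[of _ n]) auto
qed

lemma limsup_ereal_eqI:
  fixes a :: "nat \<Rightarrow> real"
  assumes "\<And>n. a n \<le> c" and "\<And>e. e > 0 \<Longrightarrow> \<exists>\<^sub>F n in sequentially. \<bar>a n - c\<bar> < e"
  shows "limsup (\<lambda>n. ereal (a n)) = ereal c"
proof (rule antisym)
  show "limsup (\<lambda>n. ereal (a n)) \<le> ereal c"
    using assms(1) by (intro Limsup_bounded) simp
  show "ereal c \<le> limsup (\<lambda>n. ereal (a n))"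
  proof (rule ccontr)
    assume "\<not> ?thesis"
    then obtain y where y: "limsup (\<lambda>n. ereal (a n)) < ereal y" "y < c"
      by (metis ereal_dense2 ereal_less(2) less_ereal.simps(1) not_le)
    then have "\<forall>\<^sub>F n in sequentially. a n < y"
      using Limsup_lessD[OF y(1)] by simp
    \<comment> \<open>A value this close to \<open>c\<close> exceeds \<open>y\<close>.\<close>
    moreover have "\<exists>\<^sub>F n in sequentially. \<bar>a n - c\<bar> < c - y"
      using assms(2) y(2) by simp
    ultimately have "\<exists>\<^sub>F n in sequentially. False"
      by (rule_tac frequently_rev_mp) (auto elim: eventually_mono)
    then show False by simp
  qed
qed

lemma liminf_ereal_eqI:
  fixes a :: "nat \<Rightarrow> real"
  assumes "\<And>n. a n \<ge> c" and "\<And>e. e > 0 \<Longrightarrow> \<exists>\<^sub>F n in sequentially. \<bar>a n - c\<bar> < e"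
  shows "liminf (\<lambda>n. ereal (a n)) = ereal c"
proof -
  have "limsup (\<lambda>n. ereal (- a n)) = ereal (- c)"
    using assms by (intro limsup_ereal_eqI) (auto simp: abs_minus_commute)
  moreover have "limsup (\<lambda>n. - ereal (a n)) = - liminf (\<lambda>n. ereal (a n))"
    by (rule ereal_Limsup_uminus)
  ultimately have "- liminf (\<lambda>n. ereal (a n)) = - ereal c"
    by simp
  then show ?thesis
    by (simp only: ereal_uminus_eq_iff)
qed

lemma close_freq_bounds: "close_freq f x y \<epsilon> n \<in> {0..1}"
proof -
  have "(\<Sum>j<n. indicator {0..<\<epsilon>} (dist (iter_seq f j x) (iter_seq f j y)) :: real) \<le> (\<Sum>j<n. 1)"
    by (intro sum_mono) (simp add: indicator_def)
  \<comment> \<open>For \<open>n = 0\<close> the frequency is 0, by the convention on division by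
    zero.\<close>
  then show ?thesis
    unfolding close_freq_def by (auto intro!: sum_nonneg divide_nonneg_nonneg simp: divide_le_eq)
qed

text \<open>The averaging estimate is applied to the indicator of closeness, equal to 1 on the
  windows; \<open>C\<close> absorbs the end of a window, where closeness is not guaranteed.\<close>

lemma limsup_close_freq:
  assumes "p > 0"
    and "\<exists>\<^sub>\<infinity>k. \<forall>j. p * fact k \<le> j \<longrightarrow> j + C < p * fact (Suc k) \<longrightarrow>
      dist (iter_seq f j x) (iter_seq f j y) < \<epsilon>"
  shows "limsup (\<lambda>n. ereal (close_freq f x y \<epsilon> n)) = 1"
proof -
  have "limsup (\<lambda>n. ereal (close_freq f x y \<epsilon> n)) = ereal 1"
  proof (rule limsup_ereal_eqI)
    show "\<exists>\<^sub>F n in sequentially. \<bar>close_freq f x y \<epsilon> n - 1\<bar> < e" if "e > 0" for e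
      unfolding close_freq_def
      by (rule average_near_window_value[OF \<open>p > 0\<close> _ _ that, where C = C])
        (use assms(2) in \<open>auto simp: indicator_def elim!: INFM_mono\<close>)
  qed (use close_freq_bounds[of f x y \<epsilon>] in auto)
  then show ?thesis
    by (simp add: one_ereal_def)
qed

lemma liminf_close_freq:
  assumes "p > 0"
    and "\<exists>\<^sub>\<infinity>k. \<forall>j. p * fact k \<le> j \<longrightarrow> j + C < p * fact (Suc k) \<longrightarrow>
      dist (iter_seq f j x) (iter_seq f j y) \<ge> \<epsilon>"
  shows "liminf (\<lambda>n. ereal (close_freq f x y \<epsilon> n)) = 0"
proof -
  have "liminf (\<lambda>n. ereal (close_freq f x y \<epsilon> n)) = ereal 0"
  proof (rule liminf_ereal_eqI)
    show "\<exists>\<^sub>F n in sequentially. \<bar>close_freq f x y \<epsilon> n - 0\<bar> < e" if "e > 0" for e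
      unfolding close_freq_def
      by (rule average_near_window_value[OF \<open>p > 0\<close> _ _ that, where C = C])
        (use assms(2) in \<open>auto simp: indicator_def not_less elim!: INFM_mono\<close>)
  qed (use close_freq_bounds[of f x y \<epsilon>] in auto)
  then show ?thesis
    by (simp add: zero_ereal_def)
qed

section \<open>Distributional chaos of the coded orbits\<close>

theorem corollary4p1:
  fixes f :: "nat \<Rightarrow> 'a::metric_space \<Rightarrow> 'a"
    and N :: nat
    and A :: "nat mat"
    and V :: "nat \<Rightarrow> 'a set"
    and W :: "nat \<Rightarrow> nat \<Rightarrow> 'a set"
  assumes "N \<ge> 2"
    and "transition_mat N A"
    and "irreducible_mat N A"
    and "\<exists>i0<N. (\<Sum>j<N. A $$ (i0, j)) \<ge> 2"
    and "\<And>i. i < N \<Longrightarrow> V i \<noteq> {}"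
    and "\<And>i. i < N \<Longrightarrow> compact (V i)"
    and "disjoint_family_on V {..<N}"
    and "equi_continuous_in f (\<Union>i<N. V i)"
    and "\<And>i n. i < N \<Longrightarrow> W i n \<noteq> {}"
    and "\<And>i n. i < N \<Longrightarrow> closed (W i n)"
    and "\<And>i n. i < N \<Longrightarrow> W i n \<subseteq> V i"
    and "weakly_coupled_expanding N A f W"
    and "\<exists>lam>(1::real). \<forall>j<N. \<forall>n. \<forall>x\<in>W j n. \<forall>y\<in>W j n.
           dist (f n x) (f n y) \<ge> lam * dist x y"
  shows "\<exists>\<delta>>0. distributionally_chaotic f \<delta>"
proof -
  obtain i0 where i0: "i0 < N" "(\<Sum>j<N. A $$ (i0, j)) \<ge> 2"
    using assms(4) by blast
  have A: "A \<in> carrier_mat N N" and A01: "\<And>i j. i < N \<Longrightarrow> j < N \<Longrightarrow> A $$ (i, j) \<in> {0, 1}"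
    using assms(2) unfolding transition_mat_def by blast+
  obtain j1 j2 where j: "j1 < N" "j2 < N" "j1 \<noteq> j2" "A $$ (i0, j1) = 1" "A $$ (i0, j2) = 1"
    using sum_ge_2_two_entries[OF i0(2) A01[OF i0(1)]] by blast
  obtain q1 u where u: "1 < q1" "u 0 = i0" "u 1 = j1" "\<And>m. u m < N"
    "\<And>m. A $$ (u m, u (Suc m)) = 1" "\<And>m. u (m mod q1) = u m"
    using loop_through[OF A A01 assms(3) i0(1) j(1,4)] by blast
  obtain q2 v where v: "1 < q2" "v 0 = i0" "v 1 = j2" "\<And>m. v m < N"
    "\<And>m. A $$ (v m, v (Suc m)) = 1" "\<And>m. v (m mod q2) = v m"
    using loop_through[OF A A01 assms(3) i0(1) j(2,5)] by blast
  define p where "p = q1 * q2"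
  have p: "1 < p"
    using less_1_mult[OF u(1) v(1)] by (simp add: p_def)
  have up: "u (m mod p) = u m" and vp: "v (m mod p) = v m" for m
    using u(6)[of "m mod p"] u(6)[of m] v(6)[of "m mod p"] v(6)[of m]
    by (simp_all add: p_def mod_mod_cancel)
  define K where "K = (\<Union>i<N. V i)"
  have K: "compact K"
    unfolding K_def using assms(6) by (intro compact_UN) auto
  have WK: "W i n \<subseteq> K" if "i < N" for i n
    using assms(11)[OF that] that unfolding K_def by blast
  have eqK: "equi_continuous_in f K"
    using assms(8) by (simp add: K_def)
  have cover: "W j (Suc n) \<subseteq> f n ` W i n" if "i < N" "j < N" "A $$ (i, j) = 1" for i j n
    using assms(12) that unfolding weakly_coupled_expanding_def by blast
  obtain lam :: real where lam: "lam > 1" and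
    exp: "\<And>j n x y. j < N \<Longrightarrow> x \<in> W j n \<Longrightarrow> y \<in> W j n \<Longrightarrow> dist (f n x) (f n y) \<ge> lam * dist x y"
    using assms(13) by blast
  obtain M where M: "\<And>x y. x \<in> K \<Longrightarrow> y \<in> K \<Longrightarrow> dist x y \<le> M"
    using compact_imp_bounded[OF K] bounded_two_points by metis
  have "V j1 \<inter> V j2 = {}"
    using assms(7) j by (simp add: disjoint_family_on_def)
  then obtain d where d: "d > 0" "\<And>x y. x \<in> V j1 \<Longrightarrow> y \<in> V j2 \<Longrightarrow> d \<le> dist x y"
    using disjoint_compacts_apart[OF assms(6)[OF j(1)] assms(6)[OF j(2)]] by blast
  \<comment> \<open>From any time, the second place of the next block of length \<open>p\<close> is
    at most \<open>p + 1\<close> steps ahead. A gap of \<open>d\<close> there therefore forces a gap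
    of \<delta> now, with \<delta> independent of time and codes.\<close>
  obtain \<delta> where \<delta>: "\<delta> > 0" and near: "\<And>n x y i. \<lbrakk>\<And>i. iter_seq f i x \<in> K \<and> iter_seq f i y \<in> K;
      dist (iter_seq f n x) (iter_seq f n y) < \<delta>; i \<le> p + 1\<rbrakk> \<Longrightarrow>
      dist (iter_seq f (n + i) x) (iter_seq f (n + i) y) < d"
    using equi_continuous_in_iterates[OF eqK d(1), of "p + 1"] by blast

  define s where "s \<alpha> n = (if window_code \<alpha> (n div p) then u n else v n)" for \<alpha> n
  have sN: "s \<alpha> n < N" for \<alpha> n
    using u(4) v(4) by (simp add: s_def)
  have sA: "A $$ (s \<alpha> n, s \<alpha> (Suc n)) = 1" for \<alpha> n
    by (rule itinerary_from_loops[OF u(5) up v(5) vp _ s_def]) (simp add: u(2) v(2))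
  have "\<exists>x. follows f W (s \<alpha>) x" for \<alpha>
    by (rule follows_exists[OF K])
      (use WK sN sA assms(9,10) cover equi_continuous_in_continuous_on[OF eqK] in auto)
  then obtain x where x: "\<And>\<alpha>. follows f W (s \<alpha>) (x \<alpha>)"
    by metis
  have xW: "iter_seq f n (x \<alpha>) \<in> W (s \<alpha> n) n" for \<alpha> n
    using x by (simp add: follows_def)
  then have xK: "iter_seq f n (x \<alpha>) \<in> K" for \<alpha> n
    using WK sN by blast

  have agree: "limsup (\<lambda>n. ereal (close_freq f (x \<alpha>) (x \<beta>) \<epsilon> n)) = 1" if "\<epsilon> > 0" for \<alpha> \<beta> \<epsilon>
  proof -
    \<comment> \<open>\<open>L\<close> steps of expansion would push a distance of \<epsilon> beyond
      the bound \<open>M\<close>.\<close>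
    obtain L where L: "M / \<epsilon> < lam ^ L"
      using real_arch_pow[OF lam] by blast
    have "dist (iter_seq f n (x \<alpha>)) (iter_seq f n (x \<beta>)) < \<epsilon>"
      if w: "\<forall>m\<in>{fact k..<fact (Suc k)}. window_code \<alpha> m = window_code \<beta> m"
        and n: "p * fact k \<le> n" "n + L < p * fact (Suc k)" for k n
    proof -
      have "s \<alpha> (n + i) = s \<beta> (n + i)" if "i < L" for i
      proof -
        \<comment> \<open>All \<open>L\<close> times fall in blocks whose indices lie in the window,
          where the codes agree.\<close>
        have "(n + i) div p < fact (Suc k)"
          using n(2) that by (intro less_mult_imp_div_less) (simp add: mult.commute)
        moreover have "fact k \<le> (n + i) div p"
          using n(1) p by (simp add: less_eq_div_iff_mult_less_eq mult.commute)
        ultimately show ?thesis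
          using w by (simp add: s_def)
      qed
      then have "lam ^ L * dist (iter_seq f n (x \<alpha>)) (iter_seq f n (x \<beta>))
          \<le> dist (iter_seq f (n + L) (x \<alpha>)) (iter_seq f (n + L) (x \<beta>))"
        using lam x
        by (intro expansion_along_itinerary[where W = W and s = "s \<alpha>" and s' = "s \<beta>"])
          (auto intro: exp[OF sN])
      also have "\<dots> \<le> M"
        using M xK by blast
      also have "M < lam ^ L * \<epsilon>"
        using L \<open>\<epsilon> > 0\<close> by (simp add: divide_less_eq)
      finally show ?thesis
        using lam by simp
    qed
    then show ?thesis
      using window_code_agree[of \<alpha> \<beta>] p
      by (intro limsup_close_freq[where p = p and C = L]) (auto elim!: INFM_mono)
  qed

  have opposite: "\<exists>\<^sub>\<infinity>k. \<forall>n. p * fact k \<le> n \<longrightarrow> n + 2 * p < p * fact (Suc k) \<longrightarrow>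
      dist (iter_seq f n (x \<alpha>)) (iter_seq f n (x \<beta>)) \<ge> \<delta>" if "\<alpha> \<noteq> \<beta>" for \<alpha> \<beta>
    using window_code_opposite[OF that]
  proof (rule INFM_mono, intro allI impI)
    fix k n
    assume w: "\<forall>m\<in>{fact k..<fact (Suc k)}. window_code \<alpha> m \<noteq> window_code \<beta> m"
      and n: "p * fact k \<le> n" "n + 2 * p < p * fact (Suc k)"
    \<comment> \<open>\<open>m\<close> is the block after the one containing \<open>n\<close>, and
      \<open>r\<close> is its second time, at which the two loops show the distinct symbols
      \<open>j1\<close> and \<open>j2\<close>.\<close>
    define m where "m = Suc (n div p)"
    define r where "r = p * m + 1"
    have n_div: "p * (n div p) \<le> n" "n < p * (n div p) + p"
      using p dividend_less_times_div[of p n] by simp_all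
    then have r: "n \<le> r" "r \<le> n + (p + 1)"
      by (auto simp: r_def m_def)
    \<comment> \<open>The margin \<open>2 * p\<close> at the end of the window keeps the next block
      inside it.\<close>
    have "p * m < p * fact (Suc k)"
      using n(2) n_div unfolding m_def mult_Suc_right by linarith
    then have "m < fact (Suc k)"
      by (rule mult_less_cancel1[THEN iffD1, THEN conjunct2])
    moreover have "fact k \<le> n div p"
      using n(1) p by (simp add: less_eq_div_iff_mult_less_eq mult.commute)
    ultimately have "window_code \<alpha> m \<noteq> window_code \<beta> m"
      using w by (simp add: m_def)
    moreover have "r div p = m" "r mod p = 1"
      using p unfolding r_def by (subst add.commute, simp only: div_mult_self2 mod_mult_self2, simp)+
    moreover from this have "u r = j1" "v r = j2"
      using up[of r] vp[of r] u(3) v(3) by metis+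
    ultimately have "s \<alpha> r = j1 \<and> s \<beta> r = j2 \<or> s \<alpha> r = j2 \<and> s \<beta> r = j1"
      by (auto simp: s_def)
    then have "d \<le> dist (iter_seq f r (x \<alpha>)) (iter_seq f r (x \<beta>))"
    proof
      assume "s \<alpha> r = j1 \<and> s \<beta> r = j2"
      then show ?thesis
        using xW[of r \<alpha>] xW[of r \<beta>] assms(11) j(1,2) by (intro d(2)) auto
    next
      assume "s \<alpha> r = j2 \<and> s \<beta> r = j1"
      then show ?thesis
        using xW[of r \<alpha>] xW[of r \<beta>] assms(11) j(1,2)
        by (subst dist_commute) (rule d(2); auto)
    qed
    moreover have "dist (iter_seq f r (x \<alpha>)) (iter_seq f r (x \<beta>)) < d"
      if "dist (iter_seq f n (x \<alpha>)) (iter_seq f n (x \<beta>)) < \<delta>"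
      using near[OF _ that, of "r - n"] xK r by simp
    ultimately show "\<delta> \<le> dist (iter_seq f n (x \<alpha>)) (iter_seq f n (x \<beta>))"
      by linarith
  qed

  have apart: "liminf (\<lambda>n. ereal (close_freq f (x \<alpha>) (x \<beta>) \<delta> n)) = 0" if "\<alpha> \<noteq> \<beta>" for \<alpha> \<beta>
    using opposite[OF that] p by (intro liminf_close_freq[where p = p and C = "2 * p"]) auto
  \<comment> \<open>A point compared with itself has frequency 1 at every \<open>n > 0\<close>.
    Distinct codes thus cannot share a point, because \<open>apart\<close> would give lower limit 0;
    so \<open>x\<close> is injective and its range uncountable.\<close>
  have self_close: "liminf (\<lambda>n. ereal (close_freq f y y \<delta> n)) \<noteq> 0" for y
  proof -
    have "close_freq f y y \<delta> n = 1" if "n > 0" for n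
      using that \<delta> by (simp add: close_freq_def)
    then have "\<forall>\<^sub>F n in sequentially. 1 \<le> ereal (close_freq f y y \<delta> n)"
      by (auto simp: eventually_sequentially one_ereal_def intro!: exI[of _ 1])
    then have "1 \<le> liminf (\<lambda>n. ereal (close_freq f y y \<delta> n))"
      by (rule Liminf_bounded)
    then show ?thesis
      by auto
  qed
  have "inj x"
  proof (rule injI, rule ccontr)
    fix \<alpha> \<beta> assume "x \<alpha> = x \<beta>" "\<alpha> \<noteq> \<beta>"
    then show False
      using apart[of \<alpha> \<beta>] self_close[of "x \<beta>"] by simp
  qed
  then have "uncountable (range x)"
    using uncountable_bool_sequences by (metis countable_image_inj_eq)
  then have "distributionally_chaotic f \<delta>"
    unfolding distributionally_chaotic_def
    using agree apart by (intro exI[of _ "range x"]) (blast dest: arg_cong[of _ _ x])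
  then show ?thesis
    using \<delta> by blast
qed

end
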